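(* Let $k$ be any positive integer. The set $\mathcal{P}_k^+$ forms a commutative ring under component-wise addition and reduction modulo $k$, $+_k$, and component-wise multiplication and reduction modulo $k$, $\cdot_k$.
   Context: Rings are not required to have a multiplicative identity. A partition is a finite weakly decreasing sequence $\lambda=(\lambda_1,\dots,\lambda_\ell)$ of positive integers; the empty partition $\emptyset$ is allowed; $\ell(\lambda)=\ell$ is its length; by convention $\lambda_j=0$ for $j>\ell(\lambda)$. $\mathcal{P}_k^+$ is the set of partitions in which the difference between any two consecutive parts is less than $k$ and the smallest part is less than $k$ (it contains $\emptyset$). Component-wise reduction modulo $k$ sends a partition $\lambda=(\lambda_1,\dots,\lambda_\ell)$ to $\lambda'=(\lambda_1',\dots,\lambda_\ell')$ (trailing zeros omitted; $\emptyset\mapsto\emptyset$), where $\lambda_\ell'=\lambda_\ell-\lfloor\lambda_\ell/k\rfloor k$ and, recursively for $j=\ell-1,\dots,1$, $\lambda_j'=\lambda_j-\left\lfloor(\lambda_j-\lambda_{j+1}')/k\right\rfloor k$. For partitions $\lambda,\pi$: $\lambda+_k\pi$ is the component-wise reduction modulo $k$ of $(\lambda_1+\pi_1,\lambda_2+\pi_2,\dots)$, and $\lambda\cdot_k\pi$ is the component-wise reduction modulo $k$ of $(\lambda_1\pi_1,\dots,\lambda_i\pi_i)$, where $i=\min\{\ell(\lambda),\ell(\pi)\}$. *)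

theory Defs
  imports "HOL-Algebra.Ring" "HOL-Library.More_List"
begin

text \<open>HOL-Algebra's \<^locale>\<open>ring\<close> includes a multiplicative identity; the following locales
  do not, and put no condition on the field \<open>one\<close> of the record.\<close>

locale nonunital_ring = abelian_group R for R (structure) +
  assumes m_closed: "\<lbrakk>x \<in> carrier R; y \<in> carrier R\<rbrakk> \<Longrightarrow> x \<otimes> y \<in> carrier R"
    and m_assoc: "\<lbrakk>x \<in> carrier R; y \<in> carrier R; z \<in> carrier R\<rbrakk>
      \<Longrightarrow> (x \<otimes> y) \<otimes> z = x \<otimes> (y \<otimes> z)"
    and l_distr: "\<lbrakk>x \<in> carrier R; y \<in> carrier R; z \<in> carrier R\<rbrakk>
      \<Longrightarrow> (x \<oplus> y) \<otimes> z = x \<otimes> z \<oplus> y \<otimes> z"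
    and r_distr: "\<lbrakk>x \<in> carrier R; y \<in> carrier R; z \<in> carrier R\<rbrakk>
      \<Longrightarrow> z \<otimes> (x \<oplus> y) = z \<otimes> x \<oplus> z \<otimes> y"

locale nonunital_cring = nonunital_ring R for R (structure) +
  assumes m_comm: "\<lbrakk>x \<in> carrier R; y \<in> carrier R\<rbrakk> \<Longrightarrow> x \<otimes> y = y \<otimes> x"

definition is_partition :: "nat list \<Rightarrow> bool" where
  "is_partition xs \<longleftrightarrow> sorted_wrt (\<ge>) xs \<and> (\<forall>a \<in> set xs. 0 < a)"

definition P_plus :: "nat \<Rightarrow> nat list set" where
  "P_plus k = {xs. is_partition xs
     \<and> (\<forall>i. Suc i < length xs \<longrightarrow> xs ! i - xs ! Suc i < k)
     \<and> (xs \<noteq> [] \<longrightarrow> last xs < k)}"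

text \<open>The recursion runs from the last part to the first; \<^term>\<open>hd r\<close> is the reduced part
  just to the right of \<^term>\<open>a\<close>. On a weakly decreasing list no subtraction truncates, since
  a reduced part never exceeds the original one, and so natural number division is the floor.\<close>

fun reduce_parts :: "nat \<Rightarrow> nat list \<Rightarrow> nat list" where
  "reduce_parts k [] = []"
| "reduce_parts k [a] = [a - (a div k) * k]"
| "reduce_parts k (a # b # as) =
     (let r = reduce_parts k (b # as) in (a - ((a - hd r) div k) * k) # r)"

definition reduction :: "nat \<Rightarrow> nat list \<Rightarrow> nat list" where
  "reduction k xs = strip_while (\<lambda>a. a = 0) (reduce_parts k xs)"

definition partition_add :: "nat \<Rightarrow> nat list \<Rightarrow> nat list \<Rightarrow> nat list" where
  "partition_add k xs ys = reduction k
     (map (\<lambda>j. nth_default 0 xs j + nth_default 0 ys j) [0..<max (length xs) (length ys)])"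

definition partition_mult :: "nat \<Rightarrow> nat list \<Rightarrow> nat list \<Rightarrow> nat list" where
  "partition_mult k xs ys = reduction k
     (map (\<lambda>j. xs ! j * ys ! j) [0..<min (length xs) (length ys)])"

definition partition_ring :: "nat \<Rightarrow> nat list ring" where
  "partition_ring k = \<lparr>carrier = P_plus k, mult = partition_mult k, one = undefined,
     zero = [], add = partition_add k\<rparr>"

end

theory Submission
  imports Defs
begin

text \<open>A partition in $\mathcal{P}_k^+$ is determined by the residues of its parts modulo $k$: going
  from the last part to the first, each part lies in a window of length $k$ that starts at the next
  part. Reduction preserves residues, so $\mathcal{P}_k^+$ embeds into the finitely supported
  sequences over $\mathbb{Z}/k$ with component-wise operations, from which it inherits all ring
  laws. The negative of $\lambda$ is the reduction of $(k-1)\lambda$.\<close>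

section \<open>Partitions as zero-padded sequences\<close>

abbreviation part :: "nat list \<Rightarrow> nat \<Rightarrow> nat" where
  "part \<equiv> nth_default 0"

text \<open>Indexing over all naturals lets partitions of different lengths be compared; this is the
  embedding into sequences over Z/k.\<close>

definition residues :: "nat \<Rightarrow> nat list \<Rightarrow> nat \<Rightarrow> nat" where
  "residues k xs j = part xs j mod k"

lemma part_strip_while_zero [simp]: "part (strip_while (\<lambda>a. a = 0) xs) = part xs"
proof -
  have "(\<lambda>a::nat. a = 0) = (=) 0" by auto
  then show ?thesis by simp
qed

lemma part_eqI:
  assumes "no_trailing (\<lambda>a. a = 0) xs" "no_trailing (\<lambda>a. a = 0) ys" "part xs = part ys"
  shows "xs = ys"
proof -
  have "(\<lambda>a::nat. a = 0) = (=) 0" by auto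
  with assms show ?thesis
    by (metis nth_default_eq_iff strip_while_idem)
qed

lemma antimono_part:
  assumes "is_partition xs"
  shows "antimono (part xs)"
proof (rule antimonoI)
  fix i j :: nat assume "i \<le> j"
  with assms show "part xs j \<le> part xs i"
    by (cases "i = j") (auto simp: is_partition_def nth_default_def sorted_wrt_iff_nth_less)
qed

text \<open>Padding merges the two gap conditions: after the last part comes the default 0, so the
  gap there is the bound on the smallest part, and further out the condition reads
  \<open>0 < k\<close>. As the parts decrease, they are all positive as soon as the last one is
  nonzero.\<close>

lemma P_plus_iff:
  assumes "0 < k"
  shows "xs \<in> P_plus k \<longleftrightarrow> no_trailing (\<lambda>a. a = 0) xs \<and> antimono (part xs)
    \<and> (\<forall>i. part xs i < part xs (Suc i) + k)" (is "_ \<longleftrightarrow> ?R")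
proof
  assume xs: "xs \<in> P_plus k"
  then have p: "is_partition xs" and d: "\<And>i. Suc i < length xs \<Longrightarrow> xs ! i - xs ! Suc i < k"
    and l: "xs \<noteq> [] \<Longrightarrow> last xs < k"
    by (auto simp: P_plus_def)
  have "no_trailing (\<lambda>a. a = 0) xs"
    using p by (auto simp: is_partition_def no_trailing_unfold)
  moreover have "part xs i < part xs (Suc i) + k" for i
  proof -
    consider "Suc i < length xs" | "Suc i = length xs" | "length xs \<le> i" by linarith
    then show ?thesis
    proof cases
      case 1
      with d[OF 1] show ?thesis by (simp add: nth_default_nth)
    next
      case 2
      then have "xs \<noteq> []" by auto
      moreover from this 2 have "last xs = part xs i"
        using last_conv_nth_default[of xs 0] by (metis diff_Suc_1)
      ultimately show ?thesis using l by simp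
    next
      case 3
      with assms show ?thesis by (simp add: nth_default_beyond)
    qed
  qed
  ultimately show ?R using antimono_part[OF p] by blast
next
  assume R: ?R
  then have anti: "\<And>i j. i \<le> j \<Longrightarrow> part xs j \<le> part xs i"
    and w: "\<And>i. part xs i < part xs (Suc i) + k"
    by (auto simp: antimono_def)
  have "0 < a" if "a \<in> set xs" for a
  proof -
    from that obtain i where i: "i < length xs" "a = xs ! i" by (auto simp: in_set_conv_nth)
    then have "xs \<noteq> []" "i \<le> length xs - 1" by auto
    with i have "last xs \<le> a"
      using anti[of i "length xs - 1"] by (simp add: nth_default_nth last_conv_nth)
    with R \<open>xs \<noteq> []\<close> show ?thesis by (auto simp: no_trailing_unfold)
  qed
  moreover have "sorted_wrt (\<ge>) xs"
    unfolding sorted_wrt_iff_nth_less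
  proof (intro allI impI)
    fix i j assume "i < j" "j < length xs"
    then show "xs ! j \<le> xs ! i" using anti[of i j] by (simp add: nth_default_nth)
  qed
  moreover have "xs ! i - xs ! Suc i < k" if "Suc i < length xs" for i
    using that w[of i] assms by (simp add: nth_default_nth)
  moreover have "last xs < k" if "xs \<noteq> []"
    using that w[of "length xs - 1"] last_conv_nth_default[of xs 0]
    by (simp add: nth_default_beyond)
  ultimately show "xs \<in> P_plus k" by (simp add: P_plus_def is_partition_def)
qed

section \<open>Recovering a partition from its residues\<close>

lemma residues_inj_on_P_plus:
  assumes "0 < k" "xs \<in> P_plus k" "ys \<in> P_plus k" "residues k xs = residues k ys"
  shows "xs = ys"
proof (rule part_eqI)
  show "no_trailing (\<lambda>a. a = 0) xs" "no_trailing (\<lambda>a. a = 0) ys"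
    using assms P_plus_iff by blast+
  \<comment> \<open>The difference of two congruent numbers in a half-open interval of length
    \<open>k\<close> is a multiple of \<open>k\<close> below \<open>k\<close>, hence 0.\<close>
  have window: "a = b" if "c \<le> a" "a < c + k" "c \<le> b" "b < c + k" "a mod k = b mod k"
    for a b c :: nat
    using that
  proof (induction a b rule: linorder_wlog)
    case (le a b)
    then have "k dvd b - a" "b - a < k"
      by (auto simp: mod_eq_dvd_iff_nat[symmetric])
    with le show ?case by (auto dest: dvd_imp_le)
  qed auto
  have bounds: "part zs (Suc i) \<le> part zs i \<and> part zs i < part zs (Suc i) + k"
    if "zs \<in> P_plus k" for zs i
    using that P_plus_iff[OF \<open>0 < k\<close>, of zs] by (auto simp: antimono_def)
  let ?n = "max (length xs) (length ys)"
  have res: "part xs i mod k = part ys i mod k" for i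
    using assms(4) by (metis residues_def)
  have "part xs i = part ys i" for i
  \<comment> \<open>Downward induction from \<open>?n\<close>, where both padded sequences vanish.
    By the induction hypothesis the parts at \<open>Suc i\<close> agree, so the parts at
    \<open>i\<close> lie in the same window.\<close>
  proof (cases "i \<le> ?n")
    case True
    then show ?thesis
    proof (induction rule: inc_induct)
      case base
      show ?case by (simp add: nth_default_beyond)
    next
      case (step i)
      show ?case
        using window[of "part xs (Suc i)" "part xs i" "part ys i"] bounds[OF assms(2), of i]
          bounds[OF assms(3), of i] step.IH res by simp
    qed
  qed (simp add: nth_default_beyond)
  then show "part xs = part ys" by blast
qed

section \<open>Reduction modulo k\<close>

lemma reduce_parts_Cons:
  "reduce_parts k (a # as) =
    (a - ((a - part (reduce_parts k as) 0) div k) * k) # reduce_parts k as"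
\<comment> \<open>The defining equation for a single part is the case of an empty tail, where the
  missing right neighbour counts as 0.\<close>
proof (cases as)
  case (Cons b bs)
  then have "reduce_parts k as \<noteq> []" by (cases bs) (auto simp: Let_def)
  then have "hd (reduce_parts k as) = part (reduce_parts k as) 0"
    by (cases "reduce_parts k as") auto
  with Cons show ?thesis by (simp add: Let_def)
qed simp

lemma antimono_part_Cons:
  "antimono (part (a # as)) \<longleftrightarrow> part as 0 \<le> a \<and> antimono (part as)"
proof -
  have "(\<forall>n. P n) \<longleftrightarrow> P 0 \<and> (\<forall>n. P (Suc n))" for P :: "nat \<Rightarrow> bool"
    by (metis not0_implies_Suc)
  from this[of "\<lambda>n. part (a # as) (Suc n) \<le> part (a # as) n"] show ?thesis
    by (simp add: antimono_iff_le_Suc)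
qed

text \<open>The bound by the original part carries the induction: together with the monotonicity of
  \<open>xs\<close> it puts the reduced right neighbour below the current part, so that the natural
  number subtraction is exact.\<close>

lemma part_reduce_parts:
  assumes "0 < k" "antimono (part xs)"
  shows "part (reduce_parts k xs) i mod k = part xs i mod k \<and>
    part (reduce_parts k xs) i \<le> part xs i \<and>
    part (reduce_parts k xs) (Suc i) \<le> part (reduce_parts k xs) i \<and>
    part (reduce_parts k xs) i < part (reduce_parts k xs) (Suc i) + k"
  using assms(2)
proof (induction xs arbitrary: i)
  case Nil
  with assms(1) show ?case by simp
next
  case (Cons a as)
  let ?h = "part (reduce_parts k as) 0"
  have "antimono (part as)" "part as 0 \<le> a"
    using Cons.prems antimono_part_Cons by blast+
  note IH = Cons.IH[OF this(1)]
  have h: "?h \<le> a" using IH[of 0] \<open>part as 0 \<le> a\<close> by linarith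
  \<comment> \<open>The new part is the representative of \<open>a\<close> modulo \<open>k\<close>
    in the window of length \<open>k\<close> starting at \<open>?h\<close>; all four claims at index
    0 follow from this form.\<close>
  have e: "a - ((a - ?h) div k) * k = ?h + (a - ?h) mod k"
    using h div_mult_mod_eq[of "a - ?h" k] by linarith
  show ?case
  proof (cases i)
    case 0
    with h e assms(1) show ?thesis
      by (simp add: reduce_parts_Cons mod_add_right_eq)
  next
    case (Suc j)
    with IH[of j] show ?thesis by (simp add: reduce_parts_Cons)
  qed
qed

lemma reduction_in_P_plus:
  assumes "0 < k" "antimono (part xs)"
  shows "reduction k xs \<in> P_plus k"
  using part_reduce_parts[OF assms]
  by (simp add: P_plus_iff[OF assms(1)] reduction_def antimono_iff_le_Suc)

lemma residues_reduction:
  assumes "0 < k" "antimono (part xs)"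
  shows "residues k (reduction k xs) = residues k xs"
  using part_reduce_parts[OF assms] by (simp add: reduction_def residues_def fun_eq_iff)

section \<open>Addition, multiplication and negatives\<close>

lemma part_add:
  "part (map (\<lambda>j. part xs j + part ys j) [0..<max (length xs) (length ys)])
    = (\<lambda>j. part xs j + part ys j)"
  by (auto simp: nth_default_def fun_eq_iff)

text \<open>Stopping at the shorter length loses nothing: beyond it one of the two factors is the
  default 0.\<close>

lemma part_mult:
  "part (map (\<lambda>j. xs ! j * ys ! j) [0..<min (length xs) (length ys)])
    = (\<lambda>j. part xs j * part ys j)"
  by (auto simp: nth_default_def fun_eq_iff)

lemma P_plus_antimono_part: "xs \<in> P_plus k \<Longrightarrow> antimono (part xs)"
  by (simp add: P_plus_def antimono_part)

lemma partition_add: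
  assumes "0 < k" "xs \<in> P_plus k" "ys \<in> P_plus k"
  shows "partition_add k xs ys \<in> P_plus k"
    and "residues k (partition_add k xs ys) = (\<lambda>j. (residues k xs j + residues k ys j) mod k)"
proof -
  let ?f = "\<lambda>j. part xs j + part ys j" and ?n = "max (length xs) (length ys)"
  \<comment> \<open>Reduction is controlled only on decreasing input, so monotonicity of the sum has
    to come first.\<close>
  have "antimono (\<lambda>j. part xs j + part ys j)"
    using assms(2,3)[THEN P_plus_antimono_part] by (auto simp: antimono_def intro: add_mono)
  then have a: "antimono (part (map ?f [0..<?n]))"
    by (simp only: part_add)
  show "partition_add k xs ys \<in> P_plus k"
    unfolding partition_add_def by (rule reduction_in_P_plus[OF assms(1) a])
  show "residues k (partition_add k xs ys) = (\<lambda>j. (residues k xs j + residues k ys j) mod k)"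
    unfolding partition_add_def residues_reduction[OF assms(1) a]
    by (simp add: residues_def part_add fun_eq_iff mod_simps)
qed

lemma partition_mult:
  assumes "0 < k" "xs \<in> P_plus k" "ys \<in> P_plus k"
  shows "partition_mult k xs ys \<in> P_plus k"
    and "residues k (partition_mult k xs ys) = (\<lambda>j. (residues k xs j * residues k ys j) mod k)"
proof -
  let ?f = "\<lambda>j. xs ! j * ys ! j" and ?n = "min (length xs) (length ys)"
  \<comment> \<open>Products of decreasing sequences decrease because the entries are
    nonnegative.\<close>
  have "antimono (\<lambda>j. part xs j * part ys j)"
    using assms(2,3)[THEN P_plus_antimono_part] by (auto simp: antimono_def intro: mult_mono)
  then have a: "antimono (part (map ?f [0..<?n]))"
    by (simp only: part_mult)
  show "partition_mult k xs ys \<in> P_plus k"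
    unfolding partition_mult_def by (rule reduction_in_P_plus[OF assms(1) a])
  show "residues k (partition_mult k xs ys) = (\<lambda>j. (residues k xs j * residues k ys j) mod k)"
    unfolding partition_mult_def residues_reduction[OF assms(1) a]
    by (simp add: residues_def part_mult fun_eq_iff mod_simps)
qed

lemma Nil_in_P_plus: "[] \<in> P_plus k"
  by (simp add: P_plus_def is_partition_def)

lemma residues_Nil: "residues k [] = (\<lambda>j. 0)"
  by (simp add: residues_def fun_eq_iff)

lemma residues_mod: "residues k xs j mod k = residues k xs j"
  by (simp add: residues_def)

lemma partition_neg:
  assumes "0 < k" "xs \<in> P_plus k"
  obtains ys where "ys \<in> P_plus k" "partition_add k ys xs = []"
proof
  \<comment> \<open>The factor \<open>k - 1\<close> represents -1 modulo \<open>k\<close>. Scaling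
    by it keeps the list decreasing, whereas negating residues part by part need not.\<close>
  let ?zs = "map ((*) (k - 1)) xs"
  let ?ys = "reduction k ?zs"
  have part_zs: "part ?zs = (\<lambda>j. (k - 1) * part xs j)"
    by (simp add: nth_default_map_eq[where dflt' = 0] fun_eq_iff)
  have "antimono (part ?zs)"
    unfolding part_zs using P_plus_antimono_part[OF assms(2)] by (simp add: antimono_def)
  note r = reduction_in_P_plus[OF assms(1) this] residues_reduction[OF assms(1) this]
  show "?ys \<in> P_plus k" by (rule r)
  have "((k - 1) * a + a) mod k = 0" for a
  proof -
    have "(k - 1) * a + a = k * a"
      using assms(1) by (cases k) simp_all
    then show ?thesis by simp
  qed
  then have "residues k (partition_add k ?ys xs) = residues k []"
    unfolding partition_add(2)[OF assms(1) r(1) assms(2)] r(2) residues_Nil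
    unfolding residues_def part_zs by (simp only: mod_simps)
  then show "partition_add k ?ys xs = []"
    using residues_inj_on_P_plus assms partition_add(1) r(1) Nil_in_P_plus by blast
qed

section \<open>The ring laws\<close>

theorem theorem7:
  fixes k :: nat
  assumes "0 < k"
  shows "nonunital_cring (partition_ring k)"
proof -
  note closed = partition_add(1)[OF assms] partition_mult(1)[OF assms]
  note residues = partition_add(2)[OF assms] partition_mult(2)[OF assms]
  \<comment> \<open>Each law follows one pattern: both sides lie in \<open>P_plus k\<close> by
    closure, so it suffices to compare residues at each index, where the law is one of arithmetic
    modulo \<open>k\<close>.\<close>
  note eqI = residues_inj_on_P_plus[OF assms]
  have "abelian_group (partition_ring k)"
  proof (rule abelian_groupI, simp_all add: partition_ring_def closed Nil_in_P_plus)
    fix x y z assume "x \<in> P_plus k" "y \<in> P_plus k" "z \<in> P_plus k"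
    then show "partition_add k (partition_add k x y) z = partition_add k x (partition_add k y z)"
      by (intro eqI) (simp_all add: closed residues mod_simps add.assoc)
  next
    fix x y assume "x \<in> P_plus k" "y \<in> P_plus k"
    then show "partition_add k x y = partition_add k y x"
      by (intro eqI) (simp_all add: closed residues add.commute)
  next
    fix x assume "x \<in> P_plus k"
    then show "partition_add k [] x = x"
      \<comment> \<open>Adding 0 leaves a second reduction of a residue modulo \<open>k\<close>,
        which \<open>residues_mod\<close> absorbs.\<close>
      by (intro eqI) (simp_all add: closed residues Nil_in_P_plus residues_Nil residues_mod)
  next
    fix x assume "x \<in> P_plus k"
    then show "\<exists>y\<in>P_plus k. partition_add k y x = []"
      using partition_neg[OF assms] by blast
  qed
  moreover have "nonunital_ring_axioms (partition_ring k)"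
  proof (unfold_locales, simp_all add: partition_ring_def closed)
    fix x y z assume "x \<in> P_plus k" "y \<in> P_plus k" "z \<in> P_plus k"
    then show "partition_mult k (partition_mult k x y) z = partition_mult k x (partition_mult k y z)"
      and "partition_mult k (partition_add k x y) z =
        partition_add k (partition_mult k x z) (partition_mult k y z)"
      and "partition_mult k z (partition_add k x y) =
        partition_add k (partition_mult k z x) (partition_mult k z y)"
      by (intro eqI; simp add: closed residues mod_simps algebra_simps)+
  qed
  moreover have "nonunital_cring_axioms (partition_ring k)"
  proof (unfold_locales, simp add: partition_ring_def)
    fix x y assume "x \<in> P_plus k" "y \<in> P_plus k"
    then show "partition_mult k x y = partition_mult k y x"
      by (intro eqI) (simp_all add: closed residues mult.commute)
  qed
  ultimately show ?thesis
    by (simp add: nonunital_cring_def nonunital_ring_def)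
qed

end
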